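(* Let $\lambda\in\mathbb{R}$ be a constant and let $u$ be a sufficiently smooth solution of $$u_t-u_{txx}+\lambda(u-u_{xx})+3u^2u_x=uu_{xxx}+2u_xu_{xx}$$ such that $u(t,x)$ and its derivatives up to second order go to $0$ as $x\to\pm\infty$, and let $u_0:=u(0,x)$. Then the functionals $$\mathcal{H}_0[u]=e^{\lambda t}\int_{\mathbb{R}}u\,dx\qquad\text{and}\qquad \mathcal{H}[u]=\frac{e^{2\lambda t}}{2}\int_{\mathbb{R}}\left(u^2+u_x^2\right)dx$$ are independent of $t$. In particular, $\mathcal{H}_0[u]\leq\mathcal{H}_0[u_0]$ and $\mathcal{H}[u]\leq\mathcal{H}[u_0]$, where $\mathcal{H}_0[u_0]$ and $\mathcal{H}[u_0]$ denote the values at $t=0$.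
   Context: $u=u(t,x)$ is real-valued, $x\in\mathbb{R}$. Derivatives up to second order include $u_t,u_x,u_{tx},u_{xx}$. "Sufficiently smooth" is understood to include that $u$ is regular enough for the equation to hold classically, that the integrals defining the functionals converge, and that one may differentiate them in $t$ under the integral sign (including $\frac{d}{dt}\int_{\mathbb{R}}(u-u_{xx})\,dx=\int_{\mathbb{R}}\partial_t(u-u_{xx})\,dx$). *)

theory Defs
  imports "HOL-Analysis.Analysis"
begin

text \<open>
  A function of time and space has type \<^typ>\<open>real \<Rightarrow> real \<Rightarrow> real\<close>, time first. The time variable
  ranges over an interval \<open>I\<close> containing 0, which may be half-open such as \<open>[0, T)\<close>; time
  derivatives are therefore taken within \<open>I\<close>, that is, one-sided at an endpoint belonging to \<open>I\<close>.
\<close>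

definition Dx :: "(real \<Rightarrow> real \<Rightarrow> real) \<Rightarrow> real \<Rightarrow> real \<Rightarrow> real" where
  "Dx u t x = deriv (u t) x"

definition Dt :: "real set \<Rightarrow> (real \<Rightarrow> real \<Rightarrow> real) \<Rightarrow> real \<Rightarrow> real \<Rightarrow> real" where
  "Dt I u t x = vector_derivative (\<lambda>s. u s x) (at t within I)"

definition has_Dx :: "real set \<Rightarrow> (real \<Rightarrow> real \<Rightarrow> real) \<Rightarrow> bool" where
  "has_Dx I u \<longleftrightarrow> (\<forall>t\<in>I. \<forall>x. u t differentiable (at x))"

definition has_Dt :: "real set \<Rightarrow> (real \<Rightarrow> real \<Rightarrow> real) \<Rightarrow> bool" where
  "has_Dt I u \<longleftrightarrow> (\<forall>t\<in>I. \<forall>x. (\<lambda>s. u s x) differentiable (at t within I))"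

definition jointly_continuous :: "real set \<Rightarrow> (real \<Rightarrow> real \<Rightarrow> real) \<Rightarrow> bool" where
  "jointly_continuous I u \<longleftrightarrow> continuous_on (I \<times> UNIV) (\<lambda>(t, x). u t x)"

text \<open>
  Regularity of a classical solution: every derivative occurring in the equation, namely
  \<open>u\<^sub>x, u\<^sub>x\<^sub>x, u\<^sub>x\<^sub>x\<^sub>x, u\<^sub>t, u\<^sub>t\<^sub>x, u\<^sub>t\<^sub>x\<^sub>x\<close>, exists and is continuous on \<open>I \<times> \<real>\<close>. Subscripts are read
  from left to right, so that \<open>u\<^sub>t\<^sub>x\<close> is \<open>(u\<^sub>t)\<^sub>x\<close>; no derivative of second order in time is required.
\<close>

definition classically_regular :: "real set \<Rightarrow> (real \<Rightarrow> real \<Rightarrow> real) \<Rightarrow> bool" where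
  "classically_regular I u \<longleftrightarrow>
     has_Dx I u \<and> has_Dx I (Dx u) \<and> has_Dx I (Dx (Dx u)) \<and>
     has_Dt I u \<and> has_Dx I (Dt I u) \<and> has_Dx I (Dx (Dt I u)) \<and>
     jointly_continuous I u \<and> jointly_continuous I (Dx u) \<and>
     jointly_continuous I (Dx (Dx u)) \<and> jointly_continuous I (Dx (Dx (Dx u))) \<and>
     jointly_continuous I (Dt I u) \<and> jointly_continuous I (Dx (Dt I u)) \<and>
     jointly_continuous I (Dx (Dx (Dt I u)))"

text \<open>
  Integrals over the line are Henstock--Kurzweil integrals. These exist, with the same value,
  whenever the Lebesgue integral or the (possibly only conditionally convergent) improper
  Riemann integral exists.
\<close>

definition diff_under_integral :: "real set \<Rightarrow> (real \<Rightarrow> real \<Rightarrow> real) \<Rightarrow> bool" where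
  "diff_under_integral I f \<longleftrightarrow>
     has_Dt I f \<and>
     (\<forall>t\<in>I. f t integrable_on UNIV \<and> Dt I f t integrable_on UNIV \<and>
        ((\<lambda>s. integral UNIV (f s)) has_real_derivative integral UNIV (Dt I f t)) (at t within I))"

definition sufficiently_smooth :: "real set \<Rightarrow> (real \<Rightarrow> real \<Rightarrow> real) \<Rightarrow> bool" where
  "sufficiently_smooth I u \<longleftrightarrow>
     classically_regular I u \<and>
     diff_under_integral I u \<and>
     diff_under_integral I (\<lambda>t x. u t x - Dx (Dx u) t x) \<and>
     diff_under_integral I (\<lambda>t x. (u t x)\<^sup>2 + (Dx u t x)\<^sup>2)"

definition solves_equation :: "real \<Rightarrow> real set \<Rightarrow> (real \<Rightarrow> real \<Rightarrow> real) \<Rightarrow> bool" where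
  "solves_equation lam I u \<longleftrightarrow>
     (\<forall>t\<in>I. \<forall>x.
        Dt I u t x - Dx (Dx (Dt I u)) t x + lam * (u t x - Dx (Dx u) t x)
          + 3 * (u t x)\<^sup>2 * Dx u t x
        = u t x * Dx (Dx (Dx u)) t x + 2 * Dx u t x * Dx (Dx u) t x)"

definition vanishes_at_ends :: "real set \<Rightarrow> (real \<Rightarrow> real \<Rightarrow> real) \<Rightarrow> bool" where
  "vanishes_at_ends I f \<longleftrightarrow> (\<forall>t\<in>I. (f t \<longlongrightarrow> 0) at_top \<and> (f t \<longlongrightarrow> 0) at_bot)"

definition decays_to_second_order :: "real set \<Rightarrow> (real \<Rightarrow> real \<Rightarrow> real) \<Rightarrow> bool" where
  "decays_to_second_order I u \<longleftrightarrow>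
     vanishes_at_ends I u \<and> vanishes_at_ends I (Dt I u) \<and> vanishes_at_ends I (Dx u) \<and>
     vanishes_at_ends I (Dx (Dt I u)) \<and> vanishes_at_ends I (Dx (Dx u))"

definition H0 :: "real \<Rightarrow> (real \<Rightarrow> real \<Rightarrow> real) \<Rightarrow> real \<Rightarrow> real" where
  "H0 lam u t = exp (lam * t) * integral UNIV (\<lambda>x. u t x)"

definition H :: "real \<Rightarrow> (real \<Rightarrow> real \<Rightarrow> real) \<Rightarrow> real \<Rightarrow> real" where
  "H lam u t = exp (2 * lam * t) / 2 * integral UNIV (\<lambda>x. (u t x)\<^sup>2 + (Dx u t x)\<^sup>2)"

end

theory Submission
  imports Defs
begin

text \<open>
  Both densities satisfy a damped balance law. Writing the equation with all spatial terms in
  divergence form gives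

    \<open>u\<^sub>t = - \<lambda> u + (u\<^sub>t\<^sub>x + \<lambda> u\<^sub>x + u u\<^sub>x\<^sub>x + u\<^sub>x\<^sup>2 / 2 - u\<^sup>3)\<^sub>x\<close>,

  and multiplying the equation by \<open>2 u\<close> and using \<open>u\<^sub>x\<^sub>t = u\<^sub>t\<^sub>x\<close> gives

    \<open>(u\<^sup>2 + u\<^sub>x\<^sup>2)\<^sub>t = - 2 \<lambda> (u\<^sup>2 + u\<^sub>x\<^sup>2) + (2 u u\<^sub>t\<^sub>x + 2 \<lambda> u u\<^sub>x + 2 u\<^sup>2 u\<^sub>x\<^sub>x - 3 u\<^sup>4 / 2)\<^sub>x\<close>.

  Both fluxes are polynomials in \<open>u, u\<^sub>x, u\<^sub>x\<^sub>x, u\<^sub>t\<^sub>x\<close> without constant term, so they tend to 0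
  at both ends and the divergences integrate to 0. An integral \<open>J\<close> of a density with damping
  rate \<open>c\<close> hence satisfies \<open>J' = - c J\<close>, and \<open>exp (c t) * J t\<close> is constant. This is
  \<open>damped_balance_law\<close>.

  Differentiating \<open>u\<^sub>x\<^sup>2\<close> in time produces \<open>u\<^sub>x\<^sub>t\<close>, while the flux contains \<open>u\<^sub>t\<^sub>x\<close>.
  The former exists and equals the latter because \<open>u\<^sub>t\<^sub>x\<close> is jointly continuous
  (\<open>mixed_derivatives_commute\<close>).
\<close>

text \<open>
  On an interval \<open>[a, b]\<close> the integral of \<open>g\<close> is \<open>G b - G a\<close>, which is small as soon as \<open>a\<close> and
  \<open>b\<close> are far out. The Henstock--Kurzweil integral over the line is the limit of these integrals,
  even where \<open>g\<close> is only conditionally integrable.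
\<close>

lemma has_integral_derivative_vanishing_at_ends:
  fixes G g :: "real \<Rightarrow> real"
  assumes deriv: "\<And>x. (G has_real_derivative g x) (at x)"
    and top: "(G \<longlongrightarrow> 0) at_top" and bot: "(G \<longlongrightarrow> 0) at_bot"
  shows "(g has_integral 0) UNIV"
proof -
  have ftc: "(g has_integral (G b - G a)) {a..b}" if "a \<le> b" for a b
    using that deriv
    by (intro fundamental_theorem_of_calculus)
       (auto simp flip: has_real_derivative_iff_has_vector_derivative
             intro: has_field_derivative_at_within)
  have int: "g integrable_on {a..b}" for a b
    using ftc[of a b] by (cases "a \<le> b") auto
  have small: "\<exists>B>0. \<forall>a b. ball 0 B \<subseteq> {a..b} \<longrightarrow> norm (integral {a..b} g) < e"
    if "e > 0" for e
  proof -
    obtain R where R: "\<And>x. x \<ge> R \<Longrightarrow> \<bar>G x\<bar> < e / 2"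
      using order_tendstoD[OF tendsto_rabs_zero[OF top], of "e / 2"] \<open>e > 0\<close>
      by (auto simp: eventually_at_top_linorder)
    obtain L where L: "\<And>x. x \<le> L \<Longrightarrow> \<bar>G x\<bar> < e / 2"
      using order_tendstoD[OF tendsto_rabs_zero[OF bot], of "e / 2"] \<open>e > 0\<close>
      by (auto simp: eventually_at_bot_linorder)
    define B where "B = max 1 (max R (- L))"
    have "norm (integral {a..b} g) < e" if sub: "ball 0 B \<subseteq> {a..b}" for a b
    proof -
      have "closure (ball 0 B) \<subseteq> {a..b}"
        using sub by (intro closure_minimal) auto
      moreover have "B \<in> closure (ball 0 B)" "- B \<in> closure (ball 0 B)"
        by (auto simp: B_def)
      ultimately have "B \<le> b" "a \<le> - B" by auto
      then have "R \<le> b" "a \<le> L" "a \<le> b" by (auto simp: B_def)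
      then have "\<bar>G b\<bar> < e / 2" "\<bar>G a\<bar> < e / 2" using R L by auto
      with integral_unique[OF ftc[OF \<open>a \<le> b\<close>]] show ?thesis by auto
    qed
    then show ?thesis by (intro exI[of _ B]) (auto simp: B_def)
  qed
  show ?thesis
    unfolding has_integral_alt' using int small by auto
qed

text \<open>
  Damping at rate \<open>c\<close> together with a flux \<open>G\<close> that vanishes at the ends yields the ordinary
  differential equation \<open>J' = - c J\<close> for the integral \<open>J\<close> of the density.
\<close>

lemma damped_balance_law:
  fixes f G :: "real \<Rightarrow> real \<Rightarrow> real"
  assumes "is_interval I"
    and diff: "diff_under_integral I f"
    and flux: "\<And>t x. t \<in> I \<Longrightarrow> (G t has_real_derivative Dt I f t x + c * f t x) (at x)"
    and ends: "vanishes_at_ends I G"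
  shows "(\<lambda>t. exp (c * t) * integral UNIV (f t)) constant_on I"
proof -
  have "((\<lambda>s. exp (c * s) * integral UNIV (f s)) has_real_derivative 0) (at t within I)"
    if t: "t \<in> I" for t
  proof -
    have int: "f t integrable_on UNIV" "Dt I f t integrable_on UNIV"
      and J: "((\<lambda>s. integral UNIV (f s)) has_real_derivative integral UNIV (Dt I f t))
               (at t within I)"
      using diff t by (auto simp: diff_under_integral_def)
    have "((\<lambda>x. Dt I f t x + c * f t x) has_integral 0) UNIV"
      using ends t flux
      by (intro has_integral_derivative_vanishing_at_ends[of "G t"])
         (auto simp: vanishes_at_ends_def)
    moreover have "((\<lambda>x. Dt I f t x + c * f t x) has_integral
        integral UNIV (Dt I f t) + c * integral UNIV (f t)) UNIV"
      using int by (intro has_integral_add has_integral_mult_right integrable_integral)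
    ultimately have "integral UNIV (Dt I f t) + c * integral UNIV (f t) = 0"
      by (rule has_integral_unique[symmetric])
    then have "integral UNIV (Dt I f t) = - c * integral UNIV (f t)"
      by simp
    with J have J': "((\<lambda>s. integral UNIV (f s)) has_real_derivative - c * integral UNIV (f t))
        (at t within I)"
      by simp
    show ?thesis
      by (rule derivative_eq_intros J' refl | simp)+
  qed
  then have "\<exists>k. \<forall>t\<in>I. exp (c * t) * integral UNIV (f t) = k"
    using has_field_derivative_zero_constant[OF is_interval_convex[OF \<open>is_interval I\<close>]] by blast
  then show ?thesis by (simp add: constant_on_def)
qed

text \<open>
  With \<open>c = u\<^sub>t\<^sub>x(t, x)\<close>, two applications of the mean value inequality, first in space and
  then in time, show that the double increment of \<open>u\<close> over the rectangle with opposite corners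
  \<open>(t, x)\<close> and \<open>(s, y)\<close> differs from \<open>c (s - t) (y - x)\<close> by at most
  \<open>\<epsilon> |s - t| |y - x|\<close>. Dividing by \<open>y - x\<close> and letting \<open>y\<close> tend to \<open>x\<close> turns this into the
  differentiability of \<open>u\<^sub>x\<close> in time, one-sided at an endpoint of \<open>I\<close>.
\<close>

lemma mixed_derivatives_commute:
  assumes "is_interval I" and t: "t \<in> I"
    and Dx: "has_Dx I u" and Dt: "has_Dt I u" and Dtx: "has_Dx I (Dt I u)"
    and cont: "jointly_continuous I (Dx (Dt I u))"
  shows "((\<lambda>s. Dx u s x) has_real_derivative Dx (Dt I u) t x) (at t within I)"
proof -
  define c where "c = Dx (Dt I u) t x"
  have ux: "(u s has_real_derivative Dx u s y) (at y)" if "s \<in> I" for s y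
    using Dx that
    by (auto simp: has_Dx_def Dx_def DERIV_deriv_iff_real_differentiable)
  have ut: "((\<lambda>s. u s y) has_real_derivative Dt I u s y) (at s within I)" if "s \<in> I" for s y
    using Dt that
    by (auto simp: has_Dt_def Dt_def has_real_derivative_iff_has_vector_derivative
        simp flip: vector_derivative_works)
  have utx: "(Dt I u s has_real_derivative Dx (Dt I u) s y) (at y)" if "s \<in> I" for s y
    using Dtx that
    by (auto simp: has_Dx_def Dx_def[of "Dt I u"] DERIV_deriv_iff_real_differentiable)
  have "\<exists>d>0. \<forall>s\<in>I. \<bar>s - t\<bar> < d \<longrightarrow> \<bar>Dx u s x - Dx u t x - c * (s - t)\<bar> \<le> e * \<bar>s - t\<bar>"
    if e: "e > 0" for e
  proof -
    have "(t, x) \<in> I \<times> UNIV" using t by simp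
    with cont e obtain d0 where d0: "d0 > 0" and
      close: "\<forall>p\<in>I \<times> UNIV. dist p (t, x) < d0 \<longrightarrow>
        dist (case p of (s, y) \<Rightarrow> Dx (Dt I u) s y) (case (t, x) of (s, y) \<Rightarrow> Dx (Dt I u) s y) < e"
      unfolding jointly_continuous_def continuous_on_iff by blast
    have near: "\<bar>Dx (Dt I u) s y - c\<bar> \<le> e"
      if "s \<in> I" "\<bar>s - t\<bar> < d0 / 2" "\<bar>y - x\<bar> < d0 / 2" for s y
    proof -
      have "dist (s, y) (t, x) < d0"
        using that sqrt_sum_squares_le_sum_abs[of "s - t" "y - x"]
        by (simp add: dist_Pair_Pair dist_real_def)
      with close \<open>s \<in> I\<close> have "dist (Dx (Dt I u) s y) c < e"
        by (force simp: c_def)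
      then show ?thesis by (simp add: dist_real_def)
    qed
    define d where "d = d0 / 2"
    have "d > 0" using d0 by (simp add: d_def)
    have space: "\<bar>Dt I u s y - Dt I u s x - c * (y - x)\<bar> \<le> e * \<bar>y - x\<bar>"
      if s: "s \<in> I" "\<bar>s - t\<bar> < d" and y: "\<bar>y - x\<bar> < d" for s y
    proof -
      have "norm ((Dt I u s y - c * y) - (Dt I u s x - c * x)) \<le> e * norm (y - x)"
      proof (rule field_differentiable_bound[of "ball x d" "\<lambda>y. Dt I u s y - c * y"
            "\<lambda>y. Dx (Dt I u) s y - c"])
        show "((\<lambda>y. Dt I u s y - c * y) has_field_derivative Dx (Dt I u) s z - c)
            (at z within ball x d)" for z
          by (rule has_field_derivative_at_within)
             (auto intro!: derivative_eq_intros utx s)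
      qed (use near s y d_def \<open>d > 0\<close> in \<open>auto simp: dist_real_def abs_minus_commute\<close>)
      then show ?thesis by (simp add: algebra_simps)
    qed
    have rect: "\<bar>(u s y - u s x) - (u t y - u t x) - c * (y - x) * (s - t)\<bar>
        \<le> e * \<bar>y - x\<bar> * \<bar>s - t\<bar>"
      if s: "s \<in> I" "\<bar>s - t\<bar> < d" and y: "\<bar>y - x\<bar> < d" for s y
    proof -
      have "norm ((u s y - u s x - c * (y - x) * s) - (u t y - u t x - c * (y - x) * t))
          \<le> e * \<bar>y - x\<bar> * norm (s - t)"
      proof (rule field_differentiable_bound[of "I \<inter> ball t d"
            "\<lambda>s. u s y - u s x - c * (y - x) * s"
            "\<lambda>s. Dt I u s y - Dt I u s x - c * (y - x)"])
        show "convex (I \<inter> ball t d)"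
          using \<open>is_interval I\<close> by (intro convex_Int convex_ball is_interval_convex)
        show "((\<lambda>s. u s y - u s x - c * (y - x) * s) has_field_derivative
            Dt I u r y - Dt I u r x - c * (y - x)) (at r within I \<inter> ball t d)"
          if "r \<in> I \<inter> ball t d" for r
          using that
          by (intro DERIV_subset[where s = I and t = "I \<inter> ball t d"])
             (auto intro!: derivative_eq_intros ut)
        show "norm (Dt I u r y - Dt I u r x - c * (y - x)) \<le> e * \<bar>y - x\<bar>"
          if "r \<in> I \<inter> ball t d" for r
          using space[of r y] that y by (simp add: dist_real_def abs_minus_commute)
      qed (use s t \<open>d > 0\<close> in \<open>simp_all add: dist_real_def abs_minus_commute\<close>)
      then show ?thesis by (simp add: algebra_simps)
    qed
    have "\<bar>Dx u s x - Dx u t x - c * (s - t)\<bar> \<le> e * \<bar>s - t\<bar>"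
      if s: "s \<in> I" "\<bar>s - t\<bar> < d" for s
    proof (rule tendsto_upperbound)
      show "((\<lambda>y. \<bar>(u s y - u s x) / (y - x) - (u t y - u t x) / (y - x) - c * (s - t)\<bar>)
          \<longlongrightarrow> \<bar>Dx u s x - Dx u t x - c * (s - t)\<bar>) (at x)"
        using ux[OF s(1), of x] ux[OF t, of x]
        unfolding has_field_derivative_iff by (intro tendsto_intros)
      have "\<bar>(u s y - u s x) / (y - x) - (u t y - u t x) / (y - x) - c * (s - t)\<bar>
          \<le> e * \<bar>s - t\<bar>" if y: "\<bar>y - x\<bar> < d" "y \<noteq> x" for y
      proof -
        have "\<bar>(u s y - u s x) / (y - x) - (u t y - u t x) / (y - x) - c * (s - t)\<bar>
            = \<bar>(u s y - u s x) - (u t y - u t x) - c * (y - x) * (s - t)\<bar> / \<bar>y - x\<bar>"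
          using y by (simp add: diff_divide_distrib flip: abs_divide)
        also have "\<dots> \<le> e * \<bar>s - t\<bar>"
          using rect[OF s y(1)] y by (simp add: field_simps)
        finally show ?thesis .
      qed
      then show "\<forall>\<^sub>F y in at x.
          \<bar>(u s y - u s x) / (y - x) - (u t y - u t x) / (y - x) - c * (s - t)\<bar> \<le> e * \<bar>s - t\<bar>"
        using \<open>d > 0\<close> by (auto simp: eventually_at dist_real_def)
    qed simp
    with \<open>d > 0\<close> show ?thesis by blast
  qed
  then show ?thesis
    unfolding has_field_derivative_def has_derivative_within_alt c_def
    by (auto simp: bounded_linear_mult_right)
qed

theorem corollary3p2:
  fixes lam :: real and I :: "real set" and u :: "real \<Rightarrow> real \<Rightarrow> real"
  assumes "is_interval I" and "0 \<in> I" and "I \<noteq> {0}"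
    and "sufficiently_smooth I u"
    and "solves_equation lam I u"
    and "decays_to_second_order I u"
  shows "H0 lam u constant_on I \<and> H lam u constant_on I \<and>
         (\<forall>t\<in>I. H0 lam u t \<le> H0 lam u 0 \<and> H lam u t \<le> H lam u 0)"
proof -
  have reg: "classically_regular I u"
    using assms(4) by (simp add: sufficiently_smooth_def)
  have deriv: "(v t has_real_derivative Dx v t x) (at x)" if "has_Dx I v" "t \<in> I" for v t x
    using that by (auto simp: has_Dx_def Dx_def DERIV_deriv_iff_real_differentiable)
  have d:
      "(u t has_real_derivative Dx u t x) (at x)"
      "(Dx u t has_real_derivative Dx (Dx u) t x) (at x)"
      "(Dx (Dx u) t has_real_derivative Dx (Dx (Dx u)) t x) (at x)"
      "(Dx (Dt I u) t has_real_derivative Dx (Dx (Dt I u)) t x) (at x)" if "t \<in> I" for t x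
    using reg that by (auto simp: classically_regular_def intro: deriv)
  have eq: "Dt I u t x = Dx (Dx (Dt I u)) t x - lam * (u t x - Dx (Dx u) t x)
      - 3 * (u t x)\<^sup>2 * Dx u t x + u t x * Dx (Dx (Dx u)) t x + 2 * Dx u t x * Dx (Dx u) t x"
    if "t \<in> I" for t x
    using assms(5) that unfolding solves_equation_def by smt
  have lim:
      "(u t \<longlongrightarrow> 0) at_top" "(u t \<longlongrightarrow> 0) at_bot"
      "(Dx u t \<longlongrightarrow> 0) at_top" "(Dx u t \<longlongrightarrow> 0) at_bot"
      "(Dx (Dx u) t \<longlongrightarrow> 0) at_top" "(Dx (Dx u) t \<longlongrightarrow> 0) at_bot"
      "(Dx (Dt I u) t \<longlongrightarrow> 0) at_top" "(Dx (Dt I u) t \<longlongrightarrow> 0) at_bot" if "t \<in> I" for t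
    using assms(6) that by (auto simp: decays_to_second_order_def vanishes_at_ends_def)

  have "H0 lam u constant_on I"
    unfolding H0_def
  proof (rule damped_balance_law[OF assms(1), where
      G = "\<lambda>t x. Dx (Dt I u) t x + lam * Dx u t x + u t x * Dx (Dx u) t x
                   + (Dx u t x)\<^sup>2 / 2 - (u t x) ^ 3"])
    show "diff_under_integral I u"
      using assms(4) by (simp add: sufficiently_smooth_def)
    show "((\<lambda>x. Dx (Dt I u) t x + lam * Dx u t x + u t x * Dx (Dx u) t x
              + (Dx u t x)\<^sup>2 / 2 - (u t x) ^ 3)
        has_real_derivative Dt I u t x + lam * u t x) (at x)" if "t \<in> I" for t x
      unfolding eq[OF that]
      by (auto intro!: derivative_eq_intros d[OF that] simp: field_simps power2_eq_square)
    show "vanishes_at_ends I (\<lambda>t x. Dx (Dt I u) t x + lam * Dx u t x + u t x * Dx (Dx u) t x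
              + (Dx u t x)\<^sup>2 / 2 - (u t x) ^ 3)"
      unfolding vanishes_at_ends_def by (safe; (rule tendsto_eq_intros lim refl | assumption | simp)+)
  qed

  have Dt_density: "Dt I (\<lambda>t x. (u t x)\<^sup>2 + (Dx u t x)\<^sup>2) t x
      = 2 * u t x * Dt I u t x + 2 * Dx u t x * Dx (Dt I u) t x" if t: "t \<in> I" for t x
    unfolding Dt_def[of I "\<lambda>t x. (u t x)\<^sup>2 + (Dx u t x)\<^sup>2"]
  proof (rule vector_derivative_within)
    \<comment> \<open>Derivatives within \<open>I\<close> are unique because a nondegenerate interval has no isolated points.\<close>
    have "t islimpt I"
      using assms(1-3) t by (intro connected_imp_perfect) (auto simp: is_interval_connected_1)
    then show "at t within I \<noteq> bot" by (simp add: trivial_limit_within)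
    have ut: "((\<lambda>s. u s x) has_real_derivative Dt I u t x) (at t within I)"
      using reg t
      by (auto simp: classically_regular_def has_Dt_def Dt_def
          has_real_derivative_iff_has_vector_derivative simp flip: vector_derivative_works)
    have uxt: "((\<lambda>s. Dx u s x) has_real_derivative Dx (Dt I u) t x) (at t within I)"
      using reg by (intro mixed_derivatives_commute assms(1) t) (auto simp: classically_regular_def)
    show "((\<lambda>s. (u s x)\<^sup>2 + (Dx u s x)\<^sup>2) has_vector_derivative
        2 * u t x * Dt I u t x + 2 * Dx u t x * Dx (Dt I u) t x) (at t within I)"
      unfolding has_real_derivative_iff_has_vector_derivative[symmetric]
      by (rule derivative_eq_intros ut uxt refl)+ simp
  qed

  have "(\<lambda>t. exp (2 * lam * t) * integral UNIV (\<lambda>x. (u t x)\<^sup>2 + (Dx u t x)\<^sup>2)) constant_on I"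
  proof (rule damped_balance_law[OF assms(1), where
      G = "\<lambda>t x. 2 * u t x * Dx (Dt I u) t x + 2 * lam * u t x * Dx u t x
                   + 2 * (u t x)\<^sup>2 * Dx (Dx u) t x - 3 / 2 * (u t x) ^ 4"])
    show "diff_under_integral I (\<lambda>t x. (u t x)\<^sup>2 + (Dx u t x)\<^sup>2)"
      using assms(4) by (simp add: sufficiently_smooth_def)
    show "((\<lambda>x. 2 * u t x * Dx (Dt I u) t x + 2 * lam * u t x * Dx u t x
              + 2 * (u t x)\<^sup>2 * Dx (Dx u) t x - 3 / 2 * (u t x) ^ 4)
        has_real_derivative Dt I (\<lambda>t x. (u t x)\<^sup>2 + (Dx u t x)\<^sup>2) t x
              + 2 * lam * ((u t x)\<^sup>2 + (Dx u t x)\<^sup>2)) (at x)" if "t \<in> I" for t x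
      unfolding Dt_density[OF that] eq[OF that]
      by (auto intro!: derivative_eq_intros d[OF that]
            simp: field_simps power2_eq_square power3_eq_cube)
    show "vanishes_at_ends I (\<lambda>t x. 2 * u t x * Dx (Dt I u) t x + 2 * lam * u t x * Dx u t x
              + 2 * (u t x)\<^sup>2 * Dx (Dx u) t x - 3 / 2 * (u t x) ^ 4)"
      unfolding vanishes_at_ends_def by (safe; (rule tendsto_eq_intros lim refl | assumption | simp)+)
  qed
  then obtain k where
    k: "\<forall>t\<in>I. exp (2 * lam * t) * integral UNIV (\<lambda>x. (u t x)\<^sup>2 + (Dx u t x)\<^sup>2) = k"
    by (auto simp: constant_on_def)
  then have "\<forall>t\<in>I. H lam u t = k / 2"
    by (simp add: H_def)
  then have "H lam u constant_on I"
    unfolding constant_on_def by blast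
  with \<open>H0 lam u constant_on I\<close> show ?thesis
    using assms(2) by (auto simp: constant_on_def)
qed

end
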